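(* Let $\mathbf{O}_{-N},\dots,\mathbf{O}_N$ ($N$ possibly infinite) be open subsets of $\mathbb{R}^2$ such that (i) $\bigcup_{i=-N}^{N}\mathbf{O}_i=\mathbb{R}^2$; (ii) for all $i$, $\mathbf{O}_i\cap\mathbf{O}_{i+j}\neq\emptyset$ if $j=\pm1$, and $\mathbf{O}_i\cap\mathbf{O}_{i+j}=\emptyset$ if $|j|>1$ (whenever both indices are in range); and let $J_{-N},\dots,J_N$ be $C^1$ functions defined on $\mathbf{O}_{-N},\dots,\mathbf{O}_N$ respectively. Define $J(x)=\min_i\{J_i(x)\mid x\in\mathbf{O}_i\}$ for $x\in\mathbb{R}^2$. Suppose that (iii) $J$ is continuous and piecewise $C^1$ on $\mathbb{R}^2$; (iv) $J(x_{\mathrm U})=0$ for every upright position $x_{\mathrm U}=[2k\pi,0]^{\mathsf T}$, $k\in\mathbb{Z}$; (v) for all $i$, $J_i$ satisfies the HJB equation everywhere on $\mathbf{O}_i$, i.e. $$\min_{u\in\mathbb{U}}\left\{c(x,u)+\frac{\partial J_i}{\partial x}(x)^{\mathsf T}f(x,u)\right\}=0\qquad\forall x\in\mathbf{O}_i;$$ (vi) the nonsmooth curve $\mathbf{\Gamma}:=\{x\in\mathbb{R}^2\mid \exists\, i\neq j \text{ with } x\in\mathbf{O}_i\cap\mathbf{O}_j \text{ and } J_i(x)=J_j(x)\}$ can be locally defined by $\{x\mid G(x)=0\}$ with $G$ a $C^1$ function, and every admissible trajectory $x(t)$ satisfies that $G(x(t))$ is monotonic in $t$ near any intersection point $x(t_0)$,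 where $G(x(t_0))=0$; (vii) for every $x_0\in\mathbb{R}^2$ there exists an admissible trajectory $(x(t),u(t))$ starting from $x(0)=x_0$ that attains cost $J(x_0)$, i.e. $\int_0^{+\infty}c(x(t),u(t))\,dt=J(x_0)$. Then $J$ is the optimal value function of the pendulum swing-up problem, i.e. $J(x_0)=J^*(x_0)$ for all $x_0\in\mathbb{R}^2$, where $$J^*(x_0)=\min_{u(\cdot)}\int_0^{+\infty}c(x(t),u(t))\,dt\quad\text{subject to } x(0)=x_0,\ u(t)\in\mathbb{U},\ \dot x(t)=f(x(t),u(t)),$$ the minimum being over admissible controls.
   Context: State: $x=[\theta,\dot\theta]^{\mathsf T}\in\mathbb{R}^2$ (with $\theta\in\mathbb{R}$ not reduced modulo $2\pi$). Dynamics: $$\dot x=f(x,u)=\begin{bmatrix}\dot\theta\\ -\frac{1}{ml^2}\left(b\dot\theta-mgl\sin\theta-u\right)\end{bmatrix},$$ where $m>0$ is the mass, $l>0$ the pole length, $b\ge 0$ the damping coefficient, $g>0$ the gravity constant, and $u\in\mathbb{R}$ the torque. Running cost: $c(x,u)=q_1\sin^2\theta+q_1(\cos\theta-1)^2+q_2\dot\theta^2+ru^2$ with $q_1,q_2,r>0$. Control set: $\mathbb{U}$ is either $\mathbb{R}$ or $[-u_{\max},u_{\max}]$ with $0<u_{\max}<mgl$. Upright positions: $x_{\mathrm U}=[2k\pi,0]^{\mathsf T}$, $k\in\mathbb{Z}$. Admissible controls (standing assumption): a control $u(t)$ with values in $\mathbb{U}$ is admissible if (i) it is piecewise continuous, and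 (ii) the resulting state trajectory satisfies $x(t)\to x_{\mathrm U}$ (one of the upright positions) as $t\to+\infty$. An admissible trajectory is a solution of $\dot x=f(x,u)$ under an admissible control. *)

theory Defs
  imports "HOL-Analysis.Analysis" "HOL-Library.Extended_Nat"
begin

text \<open>A state is a vector in the plane whose first component is the angle and whose second component
  is the angular velocity.\<close>

definition pendulum_field :: "real \<Rightarrow> real \<Rightarrow> real \<Rightarrow> real \<Rightarrow> real^2 \<Rightarrow> real \<Rightarrow> real^2" where
  "pendulum_field m l b g x u =
     vector [x $ 2, - (1 / (m * l\<^sup>2)) * (b * x $ 2 - m * g * l * sin (x $ 1) - u)]"

definition running_cost :: "real \<Rightarrow> real \<Rightarrow> real \<Rightarrow> real^2 \<Rightarrow> real \<Rightarrow> real" where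
  "running_cost q\<^sub>1 q\<^sub>2 r x u =
     q\<^sub>1 * (sin (x $ 1))\<^sup>2 + q\<^sub>1 * (cos (x $ 1) - 1)\<^sup>2 + q\<^sub>2 * (x $ 2)\<^sup>2 + r * u\<^sup>2"

definition upright :: "int \<Rightarrow> real^2" where
  "upright k = vector [2 * of_int k * pi, 0]"

text \<open>Piecewise continuity on the half-line: finitely many discontinuities in every bounded
  interval, each of them a jump with finite one-sided limits. Values at negative times are
  irrelevant here and below.\<close>

definition piecewise_continuous :: "(real \<Rightarrow> real) \<Rightarrow> bool" where
  "piecewise_continuous u \<longleftrightarrow>
     (\<forall>T. \<exists>D. finite D \<and> continuous_on ({0..T} - D) u) \<and>
     (\<forall>t\<ge>0. \<exists>a. (u \<longlongrightarrow> a) (at_right t)) \<and>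
     (\<forall>t>0. \<exists>a. (u \<longlongrightarrow> a) (at_left t))"

text \<open>At a jump of the control the trajectory is only required to be continuous.\<close>

definition solves_pendulum ::
    "real \<Rightarrow> real \<Rightarrow> real \<Rightarrow> real \<Rightarrow> (real \<Rightarrow> real^2) \<Rightarrow> (real \<Rightarrow> real) \<Rightarrow> bool" where
  "solves_pendulum m l b g x u \<longleftrightarrow>
     continuous_on {0..} x \<and>
     (\<forall>t\<ge>0. continuous (at t within {0..}) u \<longrightarrow>
        (x has_vector_derivative pendulum_field m l b g (x t) (u t)) (at t within {0..}))"

definition admissible ::
    "real \<Rightarrow> real \<Rightarrow> real \<Rightarrow> real \<Rightarrow> real set \<Rightarrow> (real \<Rightarrow> real^2) \<Rightarrow> (real \<Rightarrow> real) \<Rightarrow> bool" where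
  "admissible m l b g U x u \<longleftrightarrow>
     (\<forall>t\<ge>0. u t \<in> U) \<and> piecewise_continuous u \<and> solves_pendulum m l b g x u \<and>
     (\<exists>k. (x \<longlongrightarrow> upright k) at_top)"

text \<open>The running cost is nonnegative, so its integral always exists in the extended reals;
  it may be infinite for some admissible controls.\<close>

definition total_cost ::
    "real \<Rightarrow> real \<Rightarrow> real \<Rightarrow> (real \<Rightarrow> real^2) \<Rightarrow> (real \<Rightarrow> real) \<Rightarrow> ereal" where
  "total_cost q\<^sub>1 q\<^sub>2 r x u =
     enn2ereal (\<integral>\<^sup>+t\<in>{0..}. ennreal (running_cost q\<^sub>1 q\<^sub>2 r (x t) (u t)) \<partial>lborel)"

definition admissible_costs ::
    "real \<Rightarrow> real \<Rightarrow> real \<Rightarrow> real \<Rightarrow> real \<Rightarrow> real \<Rightarrow> real \<Rightarrow> real set \<Rightarrow> real^2 \<Rightarrow> ereal set" where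
  "admissible_costs m l b g q\<^sub>1 q\<^sub>2 r U x\<^sub>0 =
     {total_cost q\<^sub>1 q\<^sub>2 r x u | x u. admissible m l b g U x u \<and> x 0 = x\<^sub>0}"

definition is_minimum :: "'a::order set \<Rightarrow> 'a \<Rightarrow> bool" where
  "is_minimum S v \<longleftrightarrow> v \<in> S \<and> (\<forall>w\<in>S. v \<le> w)"

text \<open>The value function as an infimum; that the infimum is a minimum is a separate claim,
  expressed with \<^const>\<open>is_minimum\<close>.\<close>

definition optimal_value ::
    "real \<Rightarrow> real \<Rightarrow> real \<Rightarrow> real \<Rightarrow> real \<Rightarrow> real \<Rightarrow> real \<Rightarrow> real set \<Rightarrow> real^2 \<Rightarrow> ereal" where
  "optimal_value m l b g q\<^sub>1 q\<^sub>2 r U x\<^sub>0 = Inf (admissible_costs m l b g q\<^sub>1 q\<^sub>2 r U x\<^sub>0)"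

definition gradient :: "('a::real_inner \<Rightarrow> real) \<Rightarrow> 'a \<Rightarrow> 'a" where
  "gradient F x = (THE D. GDERIV F x :> D)"

text \<open>Only used for open sets.\<close>

definition C1_on :: "'a::real_inner set \<Rightarrow> ('a \<Rightarrow> real) \<Rightarrow> bool" where
  "C1_on S F \<longleftrightarrow> (\<forall>x\<in>S. GDERIV F x :> gradient F x) \<and> continuous_on S (gradient F)"

text \<open>Piecewise \<open>C\<^sup>1\<close> in the sense of Scholtes: locally a continuous selection of finitely many
  \<open>C\<^sup>1\<close> functions.\<close>

definition piecewise_C1_on :: "'a::real_inner set \<Rightarrow> ('a \<Rightarrow> real) \<Rightarrow> bool" where
  "piecewise_C1_on S F \<longleftrightarrow> continuous_on S F \<and>
     (\<forall>p\<in>S. \<exists>V \<F>. open V \<and> p \<in> V \<and> V \<subseteq> S \<and> finite \<F> \<and> (\<forall>H\<in>\<F>. C1_on V H) \<and>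
        (\<forall>x\<in>V. \<exists>H\<in>\<F>. F x = H x))"

text \<open>The indices from \<open>-N\<close> to \<open>N\<close>; all integers if \<open>N = \<infinity>\<close>.\<close>

definition index_range :: "enat \<Rightarrow> int set" where
  "index_range N = {i. enat (nat \<bar>i\<bar>) \<le> N}"

definition nonsmooth_curve ::
    "int set \<Rightarrow> (int \<Rightarrow> (real^2) set) \<Rightarrow> (int \<Rightarrow> real^2 \<Rightarrow> real) \<Rightarrow> (real^2) set" where
  "nonsmooth_curve I \<Omega> Jf =
     {x. \<exists>i\<in>I. \<exists>j\<in>I. i \<noteq> j \<and> x \<in> \<Omega> i \<inter> \<Omega> j \<and> Jf i x = Jf j x}"

definition satisfies_HJB_on ::
    "real \<Rightarrow> real \<Rightarrow> real \<Rightarrow> real \<Rightarrow> real \<Rightarrow> real \<Rightarrow> real \<Rightarrow> real set \<Rightarrow> (real^2) set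
      \<Rightarrow> (real^2 \<Rightarrow> real) \<Rightarrow> bool" where
  "satisfies_HJB_on m l b g q\<^sub>1 q\<^sub>2 r U S F \<longleftrightarrow>
     (\<forall>x\<in>S. is_minimum
        {running_cost q\<^sub>1 q\<^sub>2 r x u + gradient F x \<bullet> pendulum_field m l b g x u | u. u \<in> U} 0)"

text \<open>Monotonicity is weak and in either direction; at \<open>t\<^sub>0 = 0\<close> only times after \<open>t\<^sub>0\<close> count.
  Since trajectories are continuous, \<open>\<delta>\<close> can be shrunk so that \<open>G\<close> is only evaluated inside \<open>V\<close>.\<close>

definition locally_zero_set_monotonically_crossed ::
    "real \<Rightarrow> real \<Rightarrow> real \<Rightarrow> real \<Rightarrow> real set \<Rightarrow> (real^2) set \<Rightarrow> bool" where
  "locally_zero_set_monotonically_crossed m l b g U \<Gamma> \<longleftrightarrow>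
     (\<forall>p\<in>\<Gamma>. \<exists>V G. open V \<and> p \<in> V \<and> C1_on V G \<and> \<Gamma> \<inter> V = {x \<in> V. G x = 0} \<and>
        (\<forall>x u t\<^sub>0. admissible m l b g U x u \<and> 0 \<le> t\<^sub>0 \<and> x t\<^sub>0 \<in> V \<and> G (x t\<^sub>0) = 0 \<longrightarrow>
           (\<exists>\<delta>>0. mono_on {t. 0 \<le> t \<and> \<bar>t - t\<^sub>0\<bar> < \<delta>} (\<lambda>t. G (x t)) \<or>
                  antimono_on {t. 0 \<le> t \<and> \<bar>t - t\<^sub>0\<bar> < \<delta>} (\<lambda>t. G (x t)))))"

end

theory Submission
  imports Defs
begin

text \<open>
  The cost \<open>J\<close> is attained by assumption, so the content of the theorem is that no admissible
  trajectory is cheaper. The verification argument of dynamic programming gives this once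
  \<open>\<phi>(t) = J(x(t)) + \<integral>\<^sub>0\<^sup>t c(x, u)\<close> is known to be nondecreasing along every admissible
  trajectory: then \<open>J(x(0)) \<le> J(x(T)) + \<integral>\<^sub>0\<^sup>T c\<close>, and \<open>J(x(T))\<close> tends to the
  value \<open>0\<close> of \<open>J\<close> at an upright position.

  While the trajectory is in the interior of the set where \<open>J\<close> equals some \<open>J\<^sub>i\<close>, and the control is
  continuous, \<open>\<phi>' = c + \<nabla>J\<^sub>i \<bullet> f\<close>, which the HJB equation makes nonnegative. The difficulty is
  the remaining set of kinks, in which a trajectory may even stay. This is overcome by treating all
  points alike.
  Near any point, \<open>J\<close> is a continuous selection of finitely many \<open>C\<^sup>1\<close> functions \<open>H\<close>, and only
  those \<open>H\<close> matter that agree with \<open>J\<close> on an open set accumulating at the point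
  (\<open>essential_domains_cover\<close>). Every nonempty open set contains a smaller one on which \<open>J\<close> is a
  single \<open>J\<^sub>i\<close> (\<open>open_subset_where_chain_selection_is_one_function\<close>), so the inequality
  \<open>0 \<le> c + \<nabla>H \<bullet> f\<close> holds on a set accumulating at the point and passes to the point
  itself because \<open>\<nabla>H\<close> is continuous (\<open>gradient_inequality_on_essential_domain\<close>). Along the
  trajectory, each difference quotient of \<open>J\<close> is a difference quotient of one of these \<open>H\<close>;
  hence the lower right Dini derivative of \<open>\<phi>\<close> is nonnegative wherever the control is continuous
  (\<open>piecewise_C1_lower_Dini_along_curve\<close>). The control has finitely many
  discontinuities in a bounded interval, and a continuous function with a nonnegative lower right
  Dini derivative off a finite set is nondecreasing
  (\<open>nondecreasing_if_right_lower_Dini_nonneg_except_finite\<close>).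
\<close>

section \<open>Monotonicity from right lower Dini derivatives\<close>

text \<open>The \<open>\<epsilon>\<close>-inequality says that the right lower Dini derivative at \<open>t\<close> is nonnegative. For a
  fixed slope \<open>- \<epsilon>\<close>, the last point up to which the graph stays above the line of that slope
  through \<open>(c, \<phi> c)\<close> can be pushed further to the right unless it is \<open>b\<close>. The left endpoint is reached by
  continuity, which is what later allows exceptional points.\<close>

lemma nondecreasing_if_right_lower_Dini_nonneg:
  fixes \<phi> :: "real \<Rightarrow> real"
  assumes "a \<le> b"
    and cont: "continuous_on {a..b} \<phi>"
    and dini: "\<And>t \<epsilon>. \<lbrakk>a < t; t < b; 0 < \<epsilon>\<rbrakk> \<Longrightarrow> \<forall>\<^sub>F s in at_right t. \<phi> t - \<epsilon> * (s - t) \<le> \<phi> s"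
  shows "\<phi> a \<le> \<phi> b"
proof (cases "a = b")
  case False
  with \<open>a \<le> b\<close> have "a < b" by simp
  have slope: "\<phi> c - \<epsilon> * (b - c) \<le> \<phi> b" if c: "a < c" "c < b" and "0 < \<epsilon>" for c \<epsilon>
  proof -
    define S where "S = {t \<in> {c..b}. \<phi> c - \<epsilon> * (t - c) \<le> \<phi> t}"
    have "continuous_on {c..b} \<phi>"
      by (rule continuous_on_subset[OF cont]) (use c in auto)
    then have "closed S"
      unfolding S_def by (intro continuous_on_closed_Collect_le continuous_intros) auto
    moreover have "bounded S"
      by (rule bounded_subset[of "{c..b}"]) (auto simp: S_def)
    moreover have "c \<in> S" using c by (simp add: S_def)
    ultimately obtain s where s: "s \<in> S" and s_max: "\<And>t. t \<in> S \<Longrightarrow> t \<le> s"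
      using compact_attains_sup[of S] compact_eq_bounded_closed by blast
    have "s = b"
    proof (rule ccontr)
      assume "s \<noteq> b"
      with s have sb: "c \<le> s" "s < b" by (auto simp: S_def)
      have "\<forall>\<^sub>F t in at_right s. \<phi> s - \<epsilon> * (t - s) \<le> \<phi> t"
        using sb c \<open>0 < \<epsilon>\<close> by (intro dini) auto
      moreover have "\<forall>\<^sub>F t in at_right s. t \<in> {s<..<b}"
        using sb by (intro eventually_at_right_real) auto
      ultimately have "\<forall>\<^sub>F t in at_right s. \<phi> s - \<epsilon> * (t - s) \<le> \<phi> t \<and> t \<in> {s<..<b}"
        by eventually_elim auto
      then obtain t where t: "\<phi> s - \<epsilon> * (t - s) \<le> \<phi> t" "s < t" "t < b"
        using eventually_happens'[OF trivial_limit_at_right_real] by fastforce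
      have "t \<in> S"
        using t s sb by (auto simp: S_def algebra_simps)
      then show False using s_max t by fastforce
    qed
    with s show ?thesis by (simp add: S_def)
  qed
  have inner: "\<phi> c \<le> \<phi> b" if c: "a < c" "c < b" for c
  proof (rule field_le_epsilon)
    fix e :: real assume "0 < e"
    then show "\<phi> c \<le> \<phi> b + e"
      using slope[OF c, of "e / (b - c)"] c by simp
  qed
  have "(\<phi> \<longlongrightarrow> \<phi> a) (at_right a)"
    using cont \<open>a < b\<close> continuous_on_Icc_at_rightD by blast
  then show ?thesis
  proof (rule tendsto_upperbound)
    have "\<forall>\<^sub>F c in at_right a. c \<in> {a<..<b}"
      using \<open>a < b\<close> by (intro eventually_at_right_real) auto
    then show "\<forall>\<^sub>F c in at_right a. \<phi> c \<le> \<phi> b"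
      by eventually_elim (use inner in auto)
  qed simp
qed simp

text \<open>The interval is cut at the exceptional points; the derivative is then only needed in
  the open pieces.\<close>

lemma nondecreasing_if_right_lower_Dini_nonneg_except_finite:
  fixes \<phi> :: "real \<Rightarrow> real"
  assumes "finite D" "a \<le> b" "continuous_on {a..b} \<phi>"
    and "\<And>t \<epsilon>. \<lbrakk>a < t; t < b; t \<notin> D; 0 < \<epsilon>\<rbrakk> \<Longrightarrow> \<forall>\<^sub>F s in at_right t. \<phi> t - \<epsilon> * (s - t) \<le> \<phi> s"
  shows "\<phi> a \<le> \<phi> b"
  using assms
proof (induction D arbitrary: a b rule: finite_induct)
  case empty
  show ?case
    by (rule nondecreasing_if_right_lower_Dini_nonneg) (use empty in auto)
next
  case (insert d D)
  show ?case
  proof (cases "a < d \<and> d < b")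
    case True
    have "\<phi> a \<le> \<phi> d"
      by (rule insert.IH)
        (use True insert.prems in \<open>auto intro: continuous_on_subset[OF insert.prems(2)]\<close>)
    also have "\<phi> d \<le> \<phi> b"
      by (rule insert.IH)
        (use True insert.prems in \<open>auto intro: continuous_on_subset[OF insert.prems(2)]\<close>)
    finally show ?thesis .
  next
    case False
    show ?thesis
      by (rule insert.IH) (use False insert.prems in auto)
  qed
qed

lemma difference_quotient_right_tendsto:
  assumes "(h has_real_derivative d) (at t)"
  shows "((\<lambda>s. (h s - h t) / (s - t)) \<longlongrightarrow> d) (at_right t)"
  using has_field_derivative_at_within[OF assms] by (simp add: has_field_derivative_iff)

section \<open>Continuous selections of finitely many functions\<close>

lemma open_Collect_continuous_mem:
  assumes "open V" "continuous_on V h" "open B"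
  shows "open {x \<in> V. h x \<in> B}"
  using continuous_open_preimage[OF assms(2,1,3)] by (simp add: vimage_def Int_def)

text \<open>An elementary Baire argument: if \<open>F\<close> is not \<open>H\<close> throughout \<open>W\<close>, then \<open>F \<noteq> H\<close> on a
  nonempty open subset by continuity, where the remaining functions suffice.\<close>

lemma open_subset_where_selection_is_one_piece:
  fixes F :: "'a::topological_space \<Rightarrow> real"
  assumes "finite \<F>" "open W" "W \<noteq> {}" "continuous_on W F"
    and "\<And>H. H \<in> \<F> \<Longrightarrow> continuous_on W H"
    and "\<And>x. x \<in> W \<Longrightarrow> \<exists>H\<in>\<F>. F x = H x"
  shows "\<exists>H\<in>\<F>. \<exists>W'\<subseteq>W. open W' \<and> W' \<noteq> {} \<and> (\<forall>x\<in>W'. F x = H x)"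
  using assms
proof (induction \<F> arbitrary: W rule: finite_induct)
  case empty
  then show ?case by auto
next
  case (insert H \<F>)
  show ?case
  proof (cases "\<forall>x\<in>W. F x = H x")
    case True
    with insert.prems show ?thesis by blast
  next
    case False
    define W0 where "W0 = {x \<in> W. F x - H x \<in> - {0}}"
    have "open W0"
      unfolding W0_def using insert.prems
      by (intro open_Collect_continuous_mem continuous_on_diff) auto
    moreover have "W0 \<noteq> {}" "W0 \<subseteq> W" using False by (auto simp: W0_def)
    moreover have "\<exists>H\<in>\<F>. F x = H x" if "x \<in> W0" for x
      using insert.prems(5)[of x] that by (auto simp: W0_def)
    ultimately have "\<exists>H\<in>\<F>. \<exists>W'\<subseteq>W0. open W' \<and> W' \<noteq> {} \<and> (\<forall>x\<in>W'. F x = H x)"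
      using insert.prems
      by (intro insert.IH) (auto intro: continuous_on_subset[OF _ \<open>W0 \<subseteq> W\<close>])
    with \<open>W0 \<subseteq> W\<close> show ?thesis by (meson insertI2 subset_trans)
  qed
qed

text \<open>The points where \<open>H\<close> is an essentially active piece of the selection \<open>F\<close>, in Scholtes'
  terminology. The interior excludes pieces that meet \<open>F\<close> only in a thin set, whose gradients
  say nothing about \<open>F\<close>.\<close>

definition essential_domain :: "'a::topological_space set \<Rightarrow> ('a \<Rightarrow> real) \<Rightarrow> ('a \<Rightarrow> real) \<Rightarrow> 'a set" where
  "essential_domain V F H = closure (interior {x \<in> V. F x = H x})"

text \<open>The uncovered part of \<open>V\<close> is open, since there are finitely many pieces. Were it nonempty, one
  of the pieces would agree with \<open>F\<close> on an open subset of it, which is covered after all.\<close>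

lemma essential_domains_cover:
  fixes F :: "'a::topological_space \<Rightarrow> real"
  assumes "finite \<F>" "open V" "continuous_on V F"
    and "\<And>H. H \<in> \<F> \<Longrightarrow> continuous_on V H"
    and "\<And>x. x \<in> V \<Longrightarrow> \<exists>H\<in>\<F>. F x = H x"
  shows "V \<subseteq> (\<Union>H\<in>\<F>. essential_domain V F H)"
proof (rule ccontr)
  define W where "W = V - (\<Union>H\<in>\<F>. essential_domain V F H)"
  assume "\<not> ?thesis"
  then have "W \<noteq> {}" by (auto simp: W_def)
  moreover have "open W"
    unfolding W_def essential_domain_def using assms by (intro open_Diff closed_UN) auto
  moreover have "W \<subseteq> V" by (auto simp: W_def)
  moreover have "continuous_on W F" "\<And>H. H \<in> \<F> \<Longrightarrow> continuous_on W H"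
    using assms(3,4) \<open>W \<subseteq> V\<close> by (auto intro: continuous_on_subset)
  moreover have "\<And>x. x \<in> W \<Longrightarrow> \<exists>H\<in>\<F>. F x = H x"
    using assms(5) \<open>W \<subseteq> V\<close> by blast
  ultimately have "\<exists>H\<in>\<F>. \<exists>W'\<subseteq>W. open W' \<and> W' \<noteq> {} \<and> (\<forall>x\<in>W'. F x = H x)"
    using open_subset_where_selection_is_one_piece[OF \<open>finite \<F>\<close>] by blast
  then obtain H W' where H: "H \<in> \<F>" and W': "W' \<subseteq> W" "open W'" "W' \<noteq> {}"
    and eq: "\<forall>x\<in>W'. F x = H x"
    by blast
  have "W' \<subseteq> interior {x \<in> V. F x = H x}"
    using W' eq \<open>W \<subseteq> V\<close> by (intro interior_maximal) auto
  then have "W' \<subseteq> essential_domain V F H"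
    unfolding essential_domain_def using closure_subset by blast
  with W' H show False by (auto simp: W_def)
qed

section \<open>Piecewise smooth functions along curves\<close>

lemma C1_on_GDERIV: "C1_on S F \<Longrightarrow> x \<in> S \<Longrightarrow> GDERIV F x :> gradient F x"
  by (simp add: C1_on_def)

lemma C1_on_imp_continuous_on: "C1_on S F \<Longrightarrow> continuous_on S F"
  unfolding C1_on_def gderiv_def
  by (blast intro: continuous_at_imp_continuous_on has_derivative_continuous)

lemma gradient_eqI:
  assumes "GDERIV F x :> D" shows "gradient F x = D"
  unfolding gradient_def
proof (rule the_equality)
  fix D' assume "GDERIV F x :> D'"
  then have "(\<lambda>h. h \<bullet> D') = (\<lambda>h. h \<bullet> D)"
    using assms has_derivative_unique unfolding gderiv_def by blast
  then show "D' = D"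
    by (metis inner_commute vector_eq_rdot)
qed (fact assms)

lemma gradient_cong_open:
  assumes "C1_on V G" "x \<in> V" "open W" "x \<in> W" "\<And>y. y \<in> W \<Longrightarrow> F y = G y"
  shows "gradient F x = gradient G x"
proof (rule gradient_eqI)
  show "GDERIV F x :> gradient G x"
    using C1_on_GDERIV[OF assms(1,2)] assms(3-)
    unfolding gderiv_def by (metis has_derivative_transform_within_open)
qed

text \<open>The hypothesis \<open>dense\<close> asks for the inequality only on open sets that together are dense,
  and for the gradient of whatever smooth function represents \<open>F\<close> there. Open sets on which \<open>F\<close> is \<open>H\<close>
  accumulate at \<open>p\<close>; inside them \<open>H\<close> coincides with such a representative, so the continuous function
  \<open>\<kappa> + \<nabla>H \<bullet> w\<close> cannot be negative near \<open>p\<close>.\<close>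

lemma gradient_inequality_on_essential_domain:
  fixes F H :: "'a::real_inner \<Rightarrow> real"
  assumes V: "open V" "C1_on V H" "p \<in> V" "p \<in> essential_domain V F H"
    and cont: "continuous_on V \<kappa>" "continuous_on V w"
    and dense: "\<And>W. \<lbrakk>open W; W \<noteq> {}\<rbrakk> \<Longrightarrow>
      \<exists>G. \<exists>W'\<subseteq>W. open W' \<and> W' \<noteq> {} \<and> C1_on W' G \<and> (\<forall>x\<in>W'. F x = G x) \<and>
        (\<forall>x\<in>W'. 0 \<le> \<kappa> x + gradient G x \<bullet> w x)"
  shows "0 \<le> \<kappa> p + gradient H p \<bullet> w p"
proof (rule ccontr)
  assume neg: "\<not> ?thesis"
  define N where "N = {x \<in> V. \<kappa> x + gradient H x \<bullet> w x \<in> {..<0}}"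
  have "continuous_on V (gradient H)" using V by (simp add: C1_on_def)
  then have "open N"
    unfolding N_def using V cont
    by (intro open_Collect_continuous_mem continuous_intros) auto
  moreover have "p \<in> N" using neg V by (simp add: N_def)
  ultimately have ne: "N \<inter> interior {x \<in> V. F x = H x} \<noteq> {}"
    using V open_Int_closure_eq_empty unfolding essential_domain_def by blast
  have op: "open (N \<inter> interior {x \<in> V. F x = H x})"
    using \<open>open N\<close> by auto
  from dense[OF op ne] obtain G W'
    where W': "W' \<subseteq> N \<inter> interior {x \<in> V. F x = H x}" "open W'" "W' \<noteq> {}"
      and G: "C1_on W' G" "\<forall>x\<in>W'. F x = G x" "\<forall>x\<in>W'. 0 \<le> \<kappa> x + gradient G x \<bullet> w x"
    by blast
  then obtain y where y: "y \<in> W'" by blast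
  have "H x = G x" if "x \<in> W'" for x
    using that W' G interior_subset by fastforce
  then have "gradient H y = gradient G y"
    using gradient_cong_open[OF G(1) y \<open>open W'\<close> y] by blast
  with G y W' show False by (fastforce simp: N_def)
qed

text \<open>The difference quotient of \<open>F\<close> along the curve from \<open>t\<close> to \<open>s\<close> is that of a piece \<open>H\<close> with
  \<open>x s\<close> in its essential domain. If \<open>x t\<close> is outside this closed set, then so is \<open>x s\<close> for \<open>s\<close> near
  \<open>t\<close>. Otherwise the quotient tends to \<open>\<nabla>H (x t) \<bullet> v \<ge> - \<kappa>\<close>. Finitely many pieces give finitely
  many conditions on \<open>s\<close>. The piece may vary with \<open>s\<close>, so the curve may oscillate between them.\<close>

lemma piecewise_C1_lower_Dini_along_curve:
  fixes x :: "real \<Rightarrow> 'a::real_inner"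
  assumes F: "piecewise_C1_on S F" "x t \<in> S"
    and x: "(x has_vector_derivative v) (at t)"
    and bound: "\<And>V H. \<lbrakk>open V; C1_on V H; x t \<in> V; x t \<in> essential_domain V F H\<rbrakk>
      \<Longrightarrow> 0 \<le> \<kappa> + gradient H (x t) \<bullet> v"
    and "0 < \<epsilon>"
  shows "\<forall>\<^sub>F s in at_right t. F (x t) - (\<kappa> + \<epsilon>) * (s - t) \<le> F (x s)"
proof -
  obtain V \<F> where V: "open V" "x t \<in> V" "V \<subseteq> S" and "finite \<F>"
    and C1: "\<And>H. H \<in> \<F> \<Longrightarrow> C1_on V H" and sel: "\<And>y. y \<in> V \<Longrightarrow> \<exists>H\<in>\<F>. F y = H y"
    using F unfolding piecewise_C1_on_def by meson
  have contF: "continuous_on V F"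
    using F V continuous_on_subset unfolding piecewise_C1_on_def by blast
  have contH: "continuous_on V H" if "H \<in> \<F>" for H
    using C1 that C1_on_imp_continuous_on by blast
  have cover: "V \<subseteq> (\<Union>H\<in>\<F>. essential_domain V F H)"
    using essential_domains_cover[OF \<open>finite \<F>\<close> V(1) contF contH sel] .
  \<comment> \<open>The essential domain is a closure, so agreement has to be extended to it by continuity.\<close>
  have agree: "F y = H y" if "H \<in> \<F>" "y \<in> V" "y \<in> essential_domain V F H" for H y
  proof (rule ccontr)
    assume "F y \<noteq> H y"
    define N where "N = {z \<in> V. F z - H z \<in> - {0}}"
    have "open N"
      unfolding N_def using contF contH that V
      by (intro open_Collect_continuous_mem continuous_intros) auto
    moreover have "y \<in> N" using \<open>F y \<noteq> H y\<close> that by (simp add: N_def)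
    ultimately have "N \<inter> interior {x \<in> V. F x = H x} \<noteq> {}"
      using that open_Int_closure_eq_empty unfolding essential_domain_def by blast
    then show False
      using interior_subset[of "{x \<in> V. F x = H x}"] by (auto simp: N_def)
  qed
  have tends: "(x \<longlongrightarrow> x t) (at_right t)"
    using has_vector_derivative_continuous[OF x] tendsto_within_subset
    unfolding continuous_within by blast
  have inV: "\<forall>\<^sub>F s in at_right t. x s \<in> V"
    using topological_tendstoD[OF tends] V by blast
  have piece: "\<forall>\<^sub>F s in at_right t. x s \<in> V \<inter> essential_domain V F H \<longrightarrow>
      F (x t) - (\<kappa> + \<epsilon>) * (s - t) \<le> F (x s)" if H: "H \<in> \<F>" for H
  proof (cases "x t \<in> essential_domain V F H")
    case False
    have "\<forall>\<^sub>F s in at_right t. x s \<in> - essential_domain V F H"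
      using topological_tendstoD[OF tends, of "- essential_domain V F H"] False
      by (auto simp: essential_domain_def)
    then show ?thesis by eventually_elim auto
  next
    case True
    have "(H has_derivative (\<lambda>h. h \<bullet> gradient H (x t))) (at (x t))"
      using C1_on_GDERIV[OF C1[OF H] V(2)] by (simp add: gderiv_def)
    from vector_derivative_diff_chain_within[OF x has_derivative_at_withinI[OF this]]
    have "((\<lambda>s. H (x s)) has_real_derivative (gradient H (x t) \<bullet> v)) (at t)"
      by (simp add: o_def has_real_derivative_iff_has_vector_derivative inner_commute)
    then have "((\<lambda>s. (H (x s) - H (x t)) / (s - t)) \<longlongrightarrow> gradient H (x t) \<bullet> v) (at_right t)"
      by (intro difference_quotient_right_tendsto)
    moreover have "- (\<kappa> + \<epsilon>) < gradient H (x t) \<bullet> v"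
      using bound[OF V(1) C1[OF H] V(2) True] \<open>0 < \<epsilon>\<close> by simp
    ultimately have "\<forall>\<^sub>F s in at_right t. - (\<kappa> + \<epsilon>) < (H (x s) - H (x t)) / (s - t)"
      using order_tendstoD(1) by blast
    moreover have "\<forall>\<^sub>F s in at_right t. t < s"
      by (simp add: eventually_at_right_less)
    ultimately show ?thesis
    proof eventually_elim
      case (elim s)
      then have "- (\<kappa> + \<epsilon>) * (s - t) < H (x s) - H (x t)"
        by (simp add: pos_less_divide_eq)
      then show ?case
        using agree[OF H] True V(2) by (auto simp: algebra_simps)
    qed
  qed
  have "\<forall>\<^sub>F s in at_right t. \<forall>H\<in>\<F>. x s \<in> V \<inter> essential_domain V F H \<longrightarrow>
      F (x t) - (\<kappa> + \<epsilon>) * (s - t) \<le> F (x s)"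
    using piece by (intro eventually_ball_finite[OF \<open>finite \<F>\<close>]) blast
  with inV show ?thesis
    by eventually_elim (use cover in blast)
qed

section \<open>The minimum over a chain of overlapping sets\<close>

text \<open>Without finiteness the minimum defining \<open>J\<close> could fail to be one of its
  members.\<close>

lemma finite_chain_indices_at:
  fixes \<Omega> :: "int \<Rightarrow> 'a set"
  assumes "\<And>i j. \<lbrakk>i \<in> I; i + j \<in> I; \<bar>j\<bar> > 1\<rbrakk> \<Longrightarrow> \<Omega> i \<inter> \<Omega> (i + j) = {}"
  shows "finite {i \<in> I. x \<in> \<Omega> i}"
proof (cases "\<exists>i\<in>I. x \<in> \<Omega> i")
  case True
  then obtain i where i: "i \<in> I" "x \<in> \<Omega> i" by blast
  have "{i \<in> I. x \<in> \<Omega> i} \<subseteq> {i - 1..i + 1}"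
  proof
    fix k assume "k \<in> {i \<in> I. x \<in> \<Omega> i}"
    then have "\<not> \<bar>k - i\<bar> > 1"
      using assms[of i "k - i"] i by auto
    then show "k \<in> {i - 1..i + 1}" by auto
  qed
  then show ?thesis using finite_subset by blast
next
  case False
  then have "{i \<in> I. x \<in> \<Omega> i} = {}" by blast
  then show ?thesis by (simp only: finite.emptyI)
qed

text \<open>The functions \<open>f i\<close> are continuous only on their own sets, and infinitely many sets may meet
  \<open>W\<close>. If two sets overlap inside \<open>W\<close>, no third set meets the overlap (three distinct integers
  differ somewhere by more than one), which leaves a selection of two continuous functions. If no
  two overlap inside \<open>W\<close>, then \<open>F\<close> is \<open>f i\<close> on all of \<open>W \<inter> \<Omega> i\<close>.\<close>

lemma open_subset_where_chain_selection_is_one_function: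
  fixes F :: "'a::topological_space \<Rightarrow> real"
  assumes op: "\<And>i. i \<in> I \<Longrightarrow> open (\<Omega> i)" and cover: "(\<Union>i\<in>I. \<Omega> i) = UNIV"
    and nonadjacent: "\<And>i j. \<lbrakk>i \<in> I; i + j \<in> I; \<bar>j\<bar> > (1::int)\<rbrakk> \<Longrightarrow> \<Omega> i \<inter> \<Omega> (i + j) = {}"
    and cont: "continuous_on UNIV F" "\<And>i. i \<in> I \<Longrightarrow> continuous_on (\<Omega> i) (f i)"
    and sel: "\<And>x. \<exists>i\<in>I. x \<in> \<Omega> i \<and> F x = f i x"
    and W: "open W" "W \<noteq> {}"
  shows "\<exists>i\<in>I. \<exists>W'\<subseteq>W \<inter> \<Omega> i. open W' \<and> W' \<noteq> {} \<and> (\<forall>x\<in>W'. F x = f i x)"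
proof (cases "\<exists>i\<in>I. \<exists>j\<in>I. i \<noteq> j \<and> W \<inter> \<Omega> i \<inter> \<Omega> j \<noteq> {}")
  case True
  then obtain i j where ij: "i \<in> I" "j \<in> I" "i \<noteq> j" and ne: "W \<inter> \<Omega> i \<inter> \<Omega> j \<noteq> {}" by blast
  have only: "k = i \<or> k = j" if "k \<in> I" "x \<in> \<Omega> i" "x \<in> \<Omega> j" "x \<in> \<Omega> k" for k x
  proof -
    have "\<bar>j - i\<bar> \<le> 1" "\<bar>k - i\<bar> \<le> 1" "\<bar>k - j\<bar> \<le> 1"
      using nonadjacent[of i "j - i"] nonadjacent[of i "k - i"] nonadjacent[of j "k - j"] that ij
      by (fastforce simp flip: not_less)+
    with ij show ?thesis by linarith
  qed
  have "\<exists>H\<in>{f i, f j}. \<exists>W'\<subseteq>W \<inter> \<Omega> i \<inter> \<Omega> j. open W' \<and> W' \<noteq> {} \<and> (\<forall>x\<in>W'. F x = H x)"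
  proof (rule open_subset_where_selection_is_one_piece)
    show "\<exists>H\<in>{f i, f j}. F x = H x" if "x \<in> W \<inter> \<Omega> i \<inter> \<Omega> j" for x
      using sel[of x] only[of _ x] that by auto
    show "continuous_on (W \<inter> \<Omega> i \<inter> \<Omega> j) H" if "H \<in> {f i, f j}" for H
      using that cont(2)[OF ij(1)] cont(2)[OF ij(2)]
      by (auto intro: continuous_on_subset)
  qed (use ij ne op W cont in \<open>auto intro: continuous_on_subset\<close>)
  then show ?thesis using ij by (metis Int_assoc Int_commute insertE le_inf_iff singletonD)
next
  case False
  obtain x i where xi: "x \<in> W" "i \<in> I" "x \<in> \<Omega> i" using W cover by blast
  have eq: "F y = f i y" if y: "y \<in> W \<inter> \<Omega> i" for y
  proof -
    obtain k where k: "k \<in> I" "y \<in> \<Omega> k" "F y = f k y" using sel[of y] by blast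
    then have "k = i" using False y xi(2) by blast
    with k show ?thesis by simp
  qed
  show ?thesis
  proof (intro bexI[of _ i] exI[of _ "W \<inter> \<Omega> i"] conjI ballI)
    show "open (W \<inter> \<Omega> i)" using W(1) op[OF xi(2)] by auto
    show "W \<inter> \<Omega> i \<noteq> {}" using xi by blast
  qed (use xi eq in auto)
qed

section \<open>Verification for the pendulum\<close>

lemma running_cost_nonneg: "\<lbrakk>0 < q\<^sub>1; 0 < q\<^sub>2; 0 < r\<rbrakk> \<Longrightarrow> 0 \<le> running_cost q\<^sub>1 q\<^sub>2 r x u"
  by (simp add: running_cost_def)

lemma continuous_on_running_cost:
  fixes S :: "'a::metric_space set"
  assumes "continuous_on S x" "continuous_on S u"
  shows "continuous_on S (\<lambda>t. running_cost q\<^sub>1 q\<^sub>2 r (x t) (u t))"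
  unfolding running_cost_def by (intro continuous_intros assms)

lemma continuous_on_pendulum_field: "continuous_on S (\<lambda>x. pendulum_field m l b g x u)"
proof -
  have "pendulum_field m l b g x u =
      (\<chi> i. if i = 1 then x $ 2 else - (1 / (m * l\<^sup>2)) * (b * x $ 2 - m * g * l * sin (x $ 1) - u))" for x
    by (simp add: pendulum_field_def vec_eq_iff forall_2)
  moreover have "continuous_on S (\<lambda>x. if i = 1 then x $ 2
      else - (1 / (m * l\<^sup>2)) * (b * x $ 2 - m * g * l * sin (x $ 1) - u))" for i :: 2
    by (cases "i = 1") (simp_all add: divide_inverse, (intro continuous_intros)+)
  ultimately show ?thesis by (simp only: continuous_on_vec_lambda)
qed

text \<open>A bound on the extended-real cost over the half-line yields both integrability and a bound for the
  gauge integral on \<open>{0..T}\<close>, for which the fundamental theorem of calculus is applied. The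
  finitely many discontinuities are removed first, to have measurability, and restored as a
  negligible set.\<close>

lemma nonneg_integral_Icc_le_nn_integral:
  fixes c :: "real \<Rightarrow> real"
  assumes D: "finite D" and cont: "continuous_on ({0..T} - D) c" and nonneg: "\<And>t. 0 \<le> c t"
    and K: "(\<integral>\<^sup>+t\<in>{0..}. ennreal (c t) \<partial>lborel) \<le> ennreal K" "0 \<le> K"
  shows "c integrable_on {0..T}" and "integral {0..T} c \<le> K"
proof -
  define S where "S = {0..T} - D"
  have "S \<in> sets borel"
    using D by (auto simp: S_def intro: finite_imp_closed borel_closed)
  have meas: "(\<lambda>t. indicator S t *\<^sub>R c t) \<in> borel_measurable lborel"
    using borel_measurable_continuous_on_indicator[OF \<open>S \<in> sets borel\<close>, of c] cont
    by (simp add: S_def)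
  have "(\<integral>\<^sup>+t. ennreal (indicator S t *\<^sub>R c t) \<partial>lborel) \<le> (\<integral>\<^sup>+t\<in>{0..}. ennreal (c t) \<partial>lborel)"
    by (rule nn_integral_mono) (auto simp: S_def indicator_def)
  with K(1) have le: "(\<integral>\<^sup>+t. ennreal (indicator S t *\<^sub>R c t) \<partial>lborel) \<le> ennreal K"
    by (rule order_trans[rotated])
  have int: "integrable lborel (\<lambda>t. indicator S t *\<^sub>R c t)"
    by (rule integrableI_nonneg[OF meas])
      (use nonneg le in \<open>auto simp: less_top[symmetric] top_unique\<close>)
  then have "set_integrable lborel S c" by (simp add: set_integrable_def)
  then have S: "c integrable_on S" "integral S c = (LINT t|lborel. indicator S t *\<^sub>R c t)"
    using set_borel_integral_eq_integral[of S c] by (simp_all add: set_lebesgue_integral_def)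
  have neg: "negligible {t \<in> S - {0..T}. c t \<noteq> 0}" "negligible {t \<in> {0..T} - S. c t \<noteq> 0}"
    by (rule negligible_subset[OF negligible_finite[OF D]]; auto simp: S_def)+
  show "c integrable_on {0..T}"
    using integrable_spike_set[OF S(1) neg] .
  have "ennreal (integral S c) \<le> ennreal K"
    using le nn_integral_eq_integral[OF int] nonneg S(2) by simp
  then show "integral {0..T} c \<le> K"
    using integral_spike_set[OF neg] K(2) by simp
qed

text \<open>At a time when the control is continuous, the accumulated cost has derivative \<open>c t\<close> while \<open>J\<close> along
  the trajectory has right lower Dini derivative at least \<open>- c t\<close>.\<close>

lemma cost_to_go_plus_cost_nondecreasing:
  assumes adm: "admissible m l b g U x u"
    and J: "piecewise_C1_on UNIV J"
    and HJB: "\<And>p v V H. \<lbrakk>v \<in> U; open V; C1_on V H; p \<in> V; p \<in> essential_domain V J H\<rbrakk>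
      \<Longrightarrow> 0 \<le> running_cost q\<^sub>1 q\<^sub>2 r p v + gradient H p \<bullet> pendulum_field m l b g p v"
    and D: "finite D" "continuous_on ({0..T} - D) u"
    and int: "(\<lambda>t. running_cost q\<^sub>1 q\<^sub>2 r (x t) (u t)) integrable_on {0..T}"
    and "0 \<le> T"
  shows "J (x 0) \<le> J (x T) + integral {0..T} (\<lambda>t. running_cost q\<^sub>1 q\<^sub>2 r (x t) (u t))"
proof -
  define c where "c = (\<lambda>t. running_cost q\<^sub>1 q\<^sub>2 r (x t) (u t))"
  define \<phi> where "\<phi> = (\<lambda>t. J (x t) + integral {0..t} c)"
  have c_int: "c integrable_on {0..T}" using int by (simp add: c_def)
  have x: "continuous_on {0..} x" using adm by (simp add: admissible_def solves_pendulum_def)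
  have J_cont: "continuous_on UNIV J" using J by (simp add: piecewise_C1_on_def)
  have Jx: "continuous_on {0..T} (\<lambda>t. J (x t))"
    by (rule continuous_on_compose2[OF J_cont continuous_on_subset[OF x]]) auto
  have "\<phi> 0 \<le> \<phi> T"
  proof (rule nondecreasing_if_right_lower_Dini_nonneg_except_finite[OF D(1) \<open>0 \<le> T\<close>])
    show "continuous_on {0..T} \<phi>"
      unfolding \<phi>_def by (intro continuous_intros Jx indefinite_integral_continuous_1 c_int)
    fix t \<epsilon> :: real assume t: "0 < t" "t < T" "t \<notin> D" and "0 < \<epsilon>"
    define A where "A = {0<..<T} - D"
    have A: "open A" "t \<in> A" "A \<subseteq> {0..T} - D"
      using t D by (auto simp: A_def finite_imp_closed)
    have "continuous_on A u" using D A continuous_on_subset by blast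
    moreover have "continuous_on A x" by (rule continuous_on_subset[OF x]) (use A in auto)
    ultimately have ut: "isCont u t" and ct: "isCont c t"
      using A continuous_on_running_cost[of A x u] continuous_on_eq_continuous_at
      unfolding c_def by blast+
    have "(x has_vector_derivative pendulum_field m l b g (x t) (u t)) (at t within {0..})"
      using adm t continuous_at_imp_continuous_at_within[OF ut]
      unfolding admissible_def solves_pendulum_def by simp
    then have x': "(x has_vector_derivative pendulum_field m l b g (x t) (u t)) (at t)"
      using at_within_open_subset[of t "{0<..}" "{0..}"] t by (auto simp: subset_iff)
    have "((\<lambda>s. integral {0..s} c) has_vector_derivative c t) (at t within {0..T} - {})"
      by (rule integral_has_vector_derivative_continuous_at)
        (use c_int t ct in \<open>auto intro: continuous_at_imp_continuous_at_within\<close>)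
    then have "((\<lambda>s. integral {0..s} c) has_real_derivative c t) (at t)"
      using at_within_Icc_at[of 0 t T] t by (simp add: has_real_derivative_iff_has_vector_derivative)
    then have "((\<lambda>s. (integral {0..s} c - integral {0..t} c) / (s - t)) \<longlongrightarrow> c t) (at_right t)"
      by (intro difference_quotient_right_tendsto)
    then have "\<forall>\<^sub>F s in at_right t. c t - \<epsilon> / 2 < (integral {0..s} c - integral {0..t} c) / (s - t)"
      using order_tendstoD(1) \<open>0 < \<epsilon>\<close> by fastforce
    moreover have "\<forall>\<^sub>F s in at_right t. J (x t) - (c t + \<epsilon> / 2) * (s - t) \<le> J (x s)"
    proof (rule piecewise_C1_lower_Dini_along_curve[OF J _ x'])
      fix V H assume "open V" "C1_on V H" "x t \<in> V" "x t \<in> essential_domain V J H"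
      moreover have "u t \<in> U" using adm t by (simp add: admissible_def)
      ultimately show "0 \<le> c t + gradient H (x t) \<bullet> pendulum_field m l b g (x t) (u t)"
        unfolding c_def by (intro HJB)
    qed (use \<open>0 < \<epsilon>\<close> in auto)
    moreover have "\<forall>\<^sub>F s in at_right t. t < s"
      by (simp add: eventually_at_right_less)
    ultimately show "\<forall>\<^sub>F s in at_right t. \<phi> t - \<epsilon> * (s - t) \<le> \<phi> s"
    proof eventually_elim
      case (elim s)
      then have "(c t - \<epsilon> / 2) * (s - t) < integral {0..s} c - integral {0..t} c"
        by (simp add: pos_less_divide_eq)
      moreover have "(c t + \<epsilon> / 2) * (s - t) = (c t - \<epsilon> / 2) * (s - t) + \<epsilon> * (s - t)"
        by (simp add: field_simps)
      ultimately show ?case using elim(2) unfolding \<phi>_def by linarith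
    qed
  qed
  then show ?thesis by (simp add: \<phi>_def c_def)
qed

text \<open>Only a finite cost needs an argument; then the remaining value \<open>J (x T)\<close> vanishes as the
  trajectory approaches an upright position.\<close>

lemma value_le_total_cost:
  assumes adm: "admissible m l b g U x u"
    and params: "0 < q\<^sub>1" "0 < q\<^sub>2" "0 < r"
    and J: "piecewise_C1_on UNIV J" "\<And>k. J (upright k) = 0"
    and HJB: "\<And>p v V H. \<lbrakk>v \<in> U; open V; C1_on V H; p \<in> V; p \<in> essential_domain V J H\<rbrakk>
      \<Longrightarrow> 0 \<le> running_cost q\<^sub>1 q\<^sub>2 r p v + gradient H p \<bullet> pendulum_field m l b g p v"
  shows "ereal (J (x 0)) \<le> total_cost q\<^sub>1 q\<^sub>2 r x u"
proof (cases "\<integral>\<^sup>+t\<in>{0..}. ennreal (running_cost q\<^sub>1 q\<^sub>2 r (x t) (u t)) \<partial>lborel" rule: ennreal_cases)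
  case (real K)
  have x: "continuous_on {0..} x" using adm by (simp add: admissible_def solves_pendulum_def)
  obtain k where k: "(x \<longlongrightarrow> upright k) at_top" using adm by (auto simp: admissible_def)
  have "isCont J (upright k)"
    using J by (auto simp: piecewise_C1_on_def continuous_on_eq_continuous_at)
  from isCont_tendsto_compose[OF this k]
  have "((\<lambda>T. J (x T)) \<longlongrightarrow> 0) at_top" by (simp add: J)
  then have "((\<lambda>T. J (x T) + K) \<longlongrightarrow> 0 + K) at_top" by (intro tendsto_intros)
  moreover have "J (x 0) \<le> J (x T) + K" if "0 \<le> T" for T
  proof -
    obtain D where D: "finite D" "continuous_on ({0..T} - D) u"
      using adm unfolding admissible_def piecewise_continuous_def by blast
    have "continuous_on ({0..T} - D) (\<lambda>t. running_cost q\<^sub>1 q\<^sub>2 r (x t) (u t))"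
      by (intro continuous_on_running_cost D continuous_on_subset[OF x]) auto
    note cost = nonneg_integral_Icc_le_nn_integral
      [OF D(1) this running_cost_nonneg[OF params] eq_refl[OF real(2)] real(1)]
    have "J (x 0) \<le> J (x T) + integral {0..T} (\<lambda>t. running_cost q\<^sub>1 q\<^sub>2 r (x t) (u t))"
      by (rule cost_to_go_plus_cost_nondecreasing[OF adm J(1) _ D cost(1) that]) (rule HJB)
    with cost(2) show ?thesis by simp
  qed
  ultimately have "J (x 0) \<le> 0 + K"
    by (intro tendsto_lowerbound[of _ _ at_top])
      (auto simp: eventually_at_top_linorder intro!: exI[of _ 0])
  with real show ?thesis by (simp add: total_cost_def)
qed (simp add: total_cost_def)

theorem theorem2:
  fixes m l b g q\<^sub>1 q\<^sub>2 r :: real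
    and U :: "real set"
    and N :: enat
    and \<Omega> :: "int \<Rightarrow> (real^2) set"
    and Jf :: "int \<Rightarrow> real^2 \<Rightarrow> real"
    and J :: "real^2 \<Rightarrow> real"
  assumes params: "m > 0" "l > 0" "b \<ge> 0" "g > 0" "q\<^sub>1 > 0" "q\<^sub>2 > 0" "r > 0"
    and control_set: "U = UNIV \<or> (\<exists>u_max. 0 < u_max \<and> u_max < m * g * l \<and> U = {-u_max..u_max})"
    and open_sets: "\<And>i. i \<in> index_range N \<Longrightarrow> open (\<Omega> i)"
    and cover: "(\<Union>i\<in>index_range N. \<Omega> i) = UNIV"
    and adjacent: "\<And>i j. \<lbrakk>i \<in> index_range N; i + j \<in> index_range N; \<bar>j\<bar> = 1\<rbrakk> \<Longrightarrow> \<Omega> i \<inter> \<Omega> (i + j) \<noteq> {}"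
    and nonadjacent: "\<And>i j. \<lbrakk>i \<in> index_range N; i + j \<in> index_range N; \<bar>j\<bar> > 1\<rbrakk> \<Longrightarrow> \<Omega> i \<inter> \<Omega> (i + j) = {}"
    and C1: "\<And>i. i \<in> index_range N \<Longrightarrow> C1_on (\<Omega> i) (Jf i)"
    and J_eq: "\<And>x. J x = Min {Jf i x | i. i \<in> index_range N \<and> x \<in> \<Omega> i}"
    and J_cont: "continuous_on UNIV J"
    and J_piecewise: "piecewise_C1_on UNIV J"
    and J_upright: "\<And>k. J (upright k) = 0"
    and HJB: "\<And>i. i \<in> index_range N \<Longrightarrow> satisfies_HJB_on m l b g q\<^sub>1 q\<^sub>2 r U (\<Omega> i) (Jf i)"
    and curve: "locally_zero_set_monotonically_crossed m l b g U (nonsmooth_curve (index_range N) \<Omega> Jf)"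
    and attained: "\<And>x\<^sub>0. \<exists>x u. admissible m l b g U x u \<and> x 0 = x\<^sub>0 \<and> total_cost q\<^sub>1 q\<^sub>2 r x u = ereal (J x\<^sub>0)"
  shows "\<forall>x\<^sub>0. optimal_value m l b g q\<^sub>1 q\<^sub>2 r U x\<^sub>0 = ereal (J x\<^sub>0) \<and>
           is_minimum (admissible_costs m l b g q\<^sub>1 q\<^sub>2 r U x\<^sub>0) (optimal_value m l b g q\<^sub>1 q\<^sub>2 r U x\<^sub>0)"
proof
  fix x\<^sub>0
  have sel: "\<exists>i\<in>index_range N. y \<in> \<Omega> i \<and> J y = Jf i y" for y
  proof -
    have "J y \<in> {Jf i y | i. i \<in> index_range N \<and> y \<in> \<Omega> i}"
      unfolding J_eq
    proof (rule Min_in)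
      show "finite {Jf i y | i. i \<in> index_range N \<and> y \<in> \<Omega> i}"
        using finite_chain_indices_at[of "index_range N" \<Omega> y, OF nonadjacent]
        by (simp add: setcompr_eq_image)
      show "{Jf i y | i. i \<in> index_range N \<and> y \<in> \<Omega> i} \<noteq> {}"
        using cover by blast
    qed
    then show ?thesis by blast
  qed
  have HJB_ineq: "0 \<le> running_cost q\<^sub>1 q\<^sub>2 r p v + gradient H p \<bullet> pendulum_field m l b g p v"
    if v: "v \<in> U" and H: "open V" "C1_on V H" "p \<in> V" "p \<in> essential_domain V J H" for p v V H
  proof (rule gradient_inequality_on_essential_domain[OF H, of "\<lambda>y. running_cost q\<^sub>1 q\<^sub>2 r y v"])
    show "continuous_on V (\<lambda>y. running_cost q\<^sub>1 q\<^sub>2 r y v)"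
      by (intro continuous_on_running_cost continuous_intros)
    fix W :: "(real^2) set" assume "open W" "W \<noteq> {}"
    then obtain i W' where i: "i \<in> index_range N" and W': "W' \<subseteq> W \<inter> \<Omega> i" "open W'" "W' \<noteq> {}"
      and eq: "\<forall>y\<in>W'. J y = Jf i y"
      using open_subset_where_chain_selection_is_one_function
        [OF open_sets cover nonadjacent J_cont C1_on_imp_continuous_on[OF C1] sel] by blast
    have "C1_on W' (Jf i)"
      using C1[OF i] W' continuous_on_subset unfolding C1_on_def by blast
    moreover have "\<forall>y\<in>W'. 0 \<le> running_cost q\<^sub>1 q\<^sub>2 r y v + gradient (Jf i) y \<bullet> pendulum_field m l b g y v"
      using HJB[OF i] W' v unfolding satisfies_HJB_on_def is_minimum_def by blast
    ultimately show "\<exists>G. \<exists>W'\<subseteq>W. open W' \<and> W' \<noteq> {} \<and> C1_on W' G \<and> (\<forall>y\<in>W'. J y = G y) \<and>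
        (\<forall>y\<in>W'. 0 \<le> running_cost q\<^sub>1 q\<^sub>2 r y v + gradient G y \<bullet> pendulum_field m l b g y v)"
      using W' eq by (intro exI[of _ "Jf i"] exI[of _ W']) auto
  qed (rule continuous_on_pendulum_field)
  have "ereal (J x\<^sub>0) \<in> admissible_costs m l b g q\<^sub>1 q\<^sub>2 r U x\<^sub>0"
    using attained[of x\<^sub>0] unfolding admissible_costs_def by (metis (mono_tags, lifting) mem_Collect_eq)
  moreover have "ereal (J x\<^sub>0) \<le> w" if w: "w \<in> admissible_costs m l b g q\<^sub>1 q\<^sub>2 r U x\<^sub>0" for w
  proof -
    obtain x u where adm: "admissible m l b g U x u" and "x 0 = x\<^sub>0" "w = total_cost q\<^sub>1 q\<^sub>2 r x u"
      using w unfolding admissible_costs_def by blast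
    moreover have "ereal (J (x 0)) \<le> total_cost q\<^sub>1 q\<^sub>2 r x u"
      by (rule value_le_total_cost[OF adm params(5-7) J_piecewise J_upright]) (rule HJB_ineq)
    ultimately show ?thesis by simp
  qed
  ultimately have min: "is_minimum (admissible_costs m l b g q\<^sub>1 q\<^sub>2 r U x\<^sub>0) (ereal (J x\<^sub>0))"
    by (simp add: is_minimum_def)
  then have "optimal_value m l b g q\<^sub>1 q\<^sub>2 r U x\<^sub>0 = ereal (J x\<^sub>0)"
    unfolding optimal_value_def is_minimum_def by (intro Inf_eqI) auto
  with min show "optimal_value m l b g q\<^sub>1 q\<^sub>2 r U x\<^sub>0 = ereal (J x\<^sub>0) \<and>
      is_minimum (admissible_costs m l b g q\<^sub>1 q\<^sub>2 r U x\<^sub>0) (optimal_value m l b g q\<^sub>1 q\<^sub>2 r U x\<^sub>0)"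
    by simp
qed

end
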